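(* There is a polynomial-time algorithm which, given a graph $G$ with maximum degree $\Delta$, outputs a semitotal dominating set $D_{st}$ of $G$ with $|D_{st}|\le (2+3\ln(\Delta+1))\,\gamma_{t2}(G)$. That is, the Minimum Semitotal Domination problem in graphs with maximum degree $\Delta$ can be approximated with approximation ratio $2+3\ln(\Delta+1)$.
   Context: Graphs are simple and connected with at least two vertices. A set $D$ of vertices of $G$ is a semitotal dominating set if $D$ is a dominating set of $G$ and every vertex of $D$ is at distance at most $2$ in $G$ from another vertex of $D$. $\gamma_{t2}(G)$ denotes the minimum cardinality of a semitotal dominating set of $G$. The Minimum Semitotal Domination problem asks for a semitotal dominating set of minimum cardinality. *)

theory Defs
  imports
    Complex_Main
    "HOL-Computational_Algebra.Polynomial"
    "Graph_Theory.Digraph_Component"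
    "Graph_Theory.Shortest_Path"
begin

section \<open>Semitotal domination\<close>

text \<open>
  An undirected simple graph is a symmetric loop-free digraph without parallel arcs, so the
  degree of a vertex is its out-degree. Distance is the minimum cost of a walk when every
  arc costs 1.
\<close>

definition max_degree :: "('a, 'b) pre_digraph \<Rightarrow> nat" where
  "max_degree G = Max (out_degree G ` verts G)"

definition distance :: "('a, 'b) pre_digraph \<Rightarrow> 'a \<Rightarrow> 'a \<Rightarrow> ereal" where
  "distance G u v = wf_digraph.\<mu> G (\<lambda>_. 1) u v"

definition dominating_set :: "('a, 'b) pre_digraph \<Rightarrow> 'a set \<Rightarrow> bool" where
  "dominating_set G D \<longleftrightarrow> D \<subseteq> verts G \<and> (\<forall>v \<in> verts G - D. \<exists>u \<in> D. u \<rightarrow>\<^bsub>G\<^esub> v)"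

definition semitotal_dominating_set :: "('a, 'b) pre_digraph \<Rightarrow> 'a set \<Rightarrow> bool" where
  "semitotal_dominating_set G D \<longleftrightarrow>
     dominating_set G D \<and> (\<forall>u \<in> D. \<exists>v \<in> D. v \<noteq> u \<and> distance G u v \<le> 2)"

definition semitotal_domination_number :: "('a, 'b) pre_digraph \<Rightarrow> nat" where
  "semitotal_domination_number G = Min (card ` {D. semitotal_dominating_set G D})"

text \<open>The minimum above ranges over a finite and nonempty set:\<close>

lemma finite_semitotal_dominating_sets:
  assumes "finite (verts G)"
  shows "finite {D. semitotal_dominating_set G D}"
proof (rule finite_subset)
  show "{D. semitotal_dominating_set G D} \<subseteq> Pow (verts G)"
    by (auto simp: semitotal_dominating_set_def dominating_set_def)
qed (simp add: assms)

lemma semitotal_dominating_set_verts: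
  fixes G :: "'a pair_pre_digraph"
  assumes "pair_graph G" "Digraph_Component.connected (with_proj G)" "card (pverts G) \<ge> 2"
  shows "semitotal_dominating_set (with_proj G) (pverts G)"
proof -
  interpret pair_graph G by fact
  have sc: "strongly_connected (with_proj G)"
    using pair_sym_arcs assms(2) by (rule symmetric_connected_imp_strongly_connected)
  have "\<exists>v \<in> pverts G. v \<noteq> u \<and> distance (with_proj G) u v \<le> 2" if u: "u \<in> pverts G" for u
  proof -
    obtain w where w: "w \<in> pverts G" "w \<noteq> u"
      using assms(3) u by (metis card_le_Suc0_iff_eq finite_verts not_less_eq_eq numeral_2_eq_2)
    have "u \<rightarrow>\<^sup>*\<^bsub>with_proj G\<^esub> w"
      using sc u w by (auto simp: strongly_connected_def)
    then obtain v where v: "(u, v) \<in> parcs G"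
      using w(2) by (metis converse_reachable_cases)
    have "v \<noteq> u" "v \<in> pverts G"
      using v no_loops wellformed by fastforce+
    moreover have "awalk u [(u, v)] v"
      using v u by (simp add: awalk_def)
    from min_cost_le_walk_cost[OF this, of "\<lambda>_. 1"]
    have "distance (with_proj G) u v \<le> 1"
      by (simp add: distance_def one_ereal_def)
    then have "distance (with_proj G) u v \<le> 2"
      by (rule order_trans) simp
    ultimately show ?thesis by blast
  qed
  then show ?thesis
    by (auto simp: semitotal_dominating_set_def dominating_set_def)
qed


section \<open>Random access machine programs and their running time\<close>

text \<open>
  The machine model is a structured random access machine: the memory consists of named arrays
  of natural numbers (a scalar is cell 0 of an array), array indices are computed at
  run time, and the only arithmetic operations are addition and truncated subtraction.
  Every elementary command and every evaluation of a guard costs one time unit. Since there is no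
  multiplication, a run of \<open>t\<close> steps only creates numbers whose bit length exceeds that of the
  input numbers by \<open>O(t)\<close>, so that polynomial time in this model coincides with polynomial time
  on Turing machines.
\<close>

type_synonym name = string
type_synonym state = "name \<Rightarrow> nat \<Rightarrow> nat"

datatype aexp =
    Const nat
  | Cell name aexp
  | Plus aexp aexp
  | Minus aexp aexp

datatype bexp =
    Less aexp aexp
  | Equal aexp aexp
  | Neg bexp
  | Conj bexp bexp

datatype com =
    Skip
  | Assign name aexp aexp
  | Seq com com
  | Cond bexp com com
  | While bexp com

primrec aval :: "aexp \<Rightarrow> state \<Rightarrow> nat" where
  "aval (Const k) s = k"
| "aval (Cell x a) s = s x (aval a s)"
| "aval (Plus a b) s = aval a s + aval b s"
| "aval (Minus a b) s = aval a s - aval b s"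

primrec bval :: "bexp \<Rightarrow> state \<Rightarrow> bool" where
  "bval (Less a b) s \<longleftrightarrow> aval a s < aval b s"
| "bval (Equal a b) s \<longleftrightarrow> aval a s = aval b s"
| "bval (Neg b) s \<longleftrightarrow> \<not> bval b s"
| "bval (Conj b c) s \<longleftrightarrow> bval b s \<and> bval c s"

text \<open>\<open>runs c s t s'\<close>: started in state \<open>s\<close>, program \<open>c\<close> halts after \<open>t\<close> steps in state \<open>s'\<close>.\<close>

inductive runs :: "com \<Rightarrow> state \<Rightarrow> nat \<Rightarrow> state \<Rightarrow> bool" where
  Skip: "runs Skip s 1 s"
| Assign: "runs (Assign x i a) s 1 (s(x := (s x)(aval i s := aval a s)))"
| Seq: "runs c s t s' \<Longrightarrow> runs d s' t' s'' \<Longrightarrow> runs (Seq c d) s (t + t') s''"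
| CondTrue: "bval b s \<Longrightarrow> runs c s t s' \<Longrightarrow> runs (Cond b c d) s (1 + t) s'"
| CondFalse: "\<not> bval b s \<Longrightarrow> runs d s t s' \<Longrightarrow> runs (Cond b c d) s (1 + t) s'"
| WhileFalse: "\<not> bval b s \<Longrightarrow> runs (While b c) s 1 s"
| WhileTrue: "bval b s \<Longrightarrow> runs c s t s' \<Longrightarrow> runs (While b c) s' t' s'' \<Longrightarrow>
    runs (While b c) s (1 + t + t') s''"

lemma runs_deterministic:
  "runs c s t s' \<Longrightarrow> runs c s u s'' \<Longrightarrow> t = u \<and> s' = s''"
proof (induction arbitrary: u s'' rule: runs.induct)
  case (Seq c s t s' d t' s1)
  from Seq.prems show ?case by cases (use Seq.IH in blast)
next
  case (WhileTrue b s c t s' t' s1)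
  from WhileTrue.prems show ?case
    by cases (use WhileTrue.hyps WhileTrue.IH in blast)+
qed (erule runs.cases; blast)+


section \<open>Graphs as inputs, vertex sets as outputs\<close>

text \<open>
  Input graphs have vertex set \<open>{0..<n}\<close>. The machine receives \<open>n\<close> in cell 0 of \<open>''n''\<close> and the
  adjacency matrix, row by row, in the first \<open>n * n\<close> cells of \<open>''adj''\<close>; all other cells
  are 0. It returns a vertex set as a characteristic vector in \<open>''out''\<close>.
\<close>

definition input_state :: "nat pair_pre_digraph \<Rightarrow> state" where
  "input_state G = (\<lambda>x k.
     let n = card (pverts G) in
     if x = ''n'' \<and> k = 0 then n
     else if x = ''adj'' \<and> k < n * n \<and> (k div n, k mod n) \<in> parcs G then 1
     else 0)"

definition output_set :: "nat pair_pre_digraph \<Rightarrow> state \<Rightarrow> nat set" where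
  "output_set G s = {v \<in> pverts G. s ''out'' v \<noteq> 0}"

end

theory Submission
  imports Defs
begin

text \<open>
  The algorithm is the greedy one for dominating sets, followed by adding one neighbour of every
  chosen vertex: each vertex of the resulting set has a neighbour in it, and the size at most
  doubles. If \<open>k\<close> vertices dominate the graph, then some closed neighbourhood contains at least a
  \<open>1/k\<close> fraction of the undominated vertices, and the number of greedy choices is at most
  \<open>k (1 + ln (n / k))\<close>, where \<open>n \<le> k (\<Delta> + 1)\<close>. This gives the ratio \<open>2 + 2 ln (\<Delta> + 1)\<close>.

  A greedy choice is found without computing a maximum by letting a threshold \<open>d\<close>
  decrease from \<open>n\<close> to \<open>1\<close> and choosing, in one sweep over the vertices for each \<open>d\<close>, every vertex
  that still has \<open>d\<close> undominated vertices in its closed neighbourhood.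
\<close>

section \<open>Total correctness with time bounds\<close>

text \<open>Runs are deterministic, so the existence of one good run is total correctness.
  \<open>T\<close> is only an upper bound, so that branches of different length can share
  it.\<close>

definition wp :: "com \<Rightarrow> nat \<Rightarrow> (state \<Rightarrow> bool) \<Rightarrow> state \<Rightarrow> bool" where
  "wp c T Q s \<longleftrightarrow> (\<exists>t s'. runs c s t s' \<and> t \<le> T \<and> Q s')"

lemma wp_mono:
  "wp c T Q s \<Longrightarrow> T \<le> T' \<Longrightarrow> (\<And>s'. Q s' \<Longrightarrow> Q' s') \<Longrightarrow> wp c T' Q' s"
  unfolding wp_def by (meson le_trans)

lemma wp_Skip: "Q s \<Longrightarrow> wp Skip (Suc T) Q s"
  unfolding wp_def by (metis One_nat_def Suc_le_mono le0 runs.Skip)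

lemma wp_Assign:
  "Q (s(x := (s x)(aval i s := aval a s))) \<Longrightarrow> wp (Assign x i a) (Suc T) Q s"
  unfolding wp_def by (metis One_nat_def Suc_le_mono le0 runs.Assign)

lemma wp_Seq:
  assumes "wp c T (wp d T' Q) s"
  shows "wp (Seq c d) (T + T') Q s"
  using assms unfolding wp_def by (meson add_mono runs.Seq)

lemma wp_Assign_Seq:
  assumes "wp d T Q (s(x := (s x)(aval i s := aval a s)))"
  shows "wp (Seq (Assign x i a) d) (Suc T) Q s"
  using wp_Seq[OF wp_Assign[of "wp d T Q", OF assms, of 0]] by simp

lemma wp_Cond:
  assumes "bval b s \<Longrightarrow> wp c T Q s" "\<not> bval b s \<Longrightarrow> wp d T Q s"
  shows "wp (Cond b c d) (Suc T) Q s"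
proof (cases "bval b s")
  case True
  then obtain t s' where "runs c s t s'" "t \<le> T" "Q s'"
    using assms unfolding wp_def by blast
  then show ?thesis
    using runs.CondTrue[OF True] unfolding wp_def by fastforce
next
  case False
  then obtain t s' where "runs d s t s'" "t \<le> T" "Q s'"
    using assms unfolding wp_def by blast
  then show ?thesis
    using runs.CondFalse[OF False] unfolding wp_def by fastforce
qed

section \<open>Counting loops\<close>

abbreviation var :: "name \<Rightarrow> aexp" where
  "var x \<equiv> Cell x (Const 0)"

abbreviation set_var :: "name \<Rightarrow> aexp \<Rightarrow> com" where
  "set_var x a \<equiv> Assign x (Const 0) a"

definition For :: "name \<Rightarrow> aexp \<Rightarrow> com \<Rightarrow> com" where
  "For i b c = Seq (set_var i (Const 0))
     (While (Less (var i) b) (Seq c (set_var i (Plus (var i) (Const 1)))))"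

text \<open>The body must leave the counter at \<open>k\<close>. A round costs \<open>T\<close> plus
  the guard and the increment; the initial assignment and the last, failing guard give the
  additional 2.\<close>

lemma wp_For:
  assumes init: "I 0 (s(i := (s i)(0 := 0)))"
    and bound: "\<And>k s. I k s \<Longrightarrow> s i 0 = k \<Longrightarrow> aval b s = N"
    and step: "\<And>k s. k < N \<Longrightarrow> I k s \<Longrightarrow> s i 0 = k \<Longrightarrow>
      wp c T (\<lambda>s'. s' i 0 = k \<and> I (Suc k) (s'(i := (s' i)(0 := Suc k)))) s"
    and final: "\<And>s. I N s \<Longrightarrow> Q s"
  shows "wp (For i b c) (2 + N * (T + 2)) Q s"
proof -
  let ?w = "While (Less (var i) b) (Seq c (set_var i (Plus (var i) (Const 1))))"
  \<comment> \<open>Generalised over the counter \<open>k\<close>; the induction is on the number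
    \<open>m\<close> of rounds left.\<close>
  have loop: "wp ?w (1 + m * (T + 2)) Q s" if "k + m = N" "I k s" "s i 0 = k" for k m s
    using that
  proof (induction m arbitrary: k s)
    case 0
    then have "\<not> bval (Less (var i) b) s" using bound by simp
    then have "runs ?w s 1 s" by (rule runs.WhileFalse)
    moreover have "Q s" using 0 final by simp
    ultimately show ?case unfolding wp_def by auto
  next
    case (Suc m)
    then have b: "bval (Less (var i) b) s" using bound by simp
    from Suc.prems step[of k s] obtain t s' where s': "runs c s t s'" "t \<le> T"
      "s' i 0 = k" "I (Suc k) (s'(i := (s' i)(0 := Suc k)))"
      unfolding wp_def by auto
    let ?s = "s'(i := (s' i)(0 := Suc k))"
    have body: "runs (Seq c (set_var i (Plus (var i) (Const 1)))) s (t + 1) ?s"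
      using runs.Seq[OF s'(1) runs.Assign[of i "Const 0" "Plus (var i) (Const 1)" s']] s'(3)
      by simp
    have "wp ?w (1 + m * (T + 2)) Q ?s"
      using Suc.prems(1) by (intro Suc.IH[OF _ s'(4)]) simp_all
    then obtain t' s'' where rest: "runs ?w ?s t' s''" "t' \<le> 1 + m * (T + 2)" "Q s''"
      unfolding wp_def by blast
    have "1 + (t + 1) + t' \<le> 1 + Suc m * (T + 2)" using rest(2) s'(2) by simp
    with runs.WhileTrue[OF b body rest(1)] rest(3) have
      "runs ?w s (1 + (t + 1) + t') s'' \<and> 1 + (t + 1) + t' \<le> 1 + Suc m * (T + 2) \<and> Q s''" by blast
    then show ?case unfolding wp_def by blast
  qed
  have "wp ?w (1 + N * (T + 2)) Q (s(i := (s i)(0 := 0)))"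
    using init by (intro loop[of 0]) auto
  then show ?thesis
    unfolding For_def using wp_Assign_Seq[of ?w "1 + N * (T + 2)" Q s i "Const 0" "Const 0"]
    by simp
qed

section \<open>Analysis of the greedy choice\<close>

definition closed_nbhd :: "'a pair_pre_digraph \<Rightarrow> 'a \<Rightarrow> 'a set" where
  "closed_nbhd G v = insert v {w. (v, w) \<in> parcs G}"

text \<open>
  An upper bound for the number of greedy choices still to be made if \<open>k\<close> vertices
  dominate and \<open>u\<close> vertices are undominated.
\<close>

definition greedy_potential :: "real \<Rightarrow> real \<Rightarrow> real" where
  "greedy_potential k u = (if u \<le> k then u else k + k * ln (u / k))"

text \<open>Across the junction the linear branch stays at most \<open>k\<close> and the logarithmic
  one at least \<open>k\<close>.\<close>

lemma greedy_potential_mono: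
  assumes "k > 0" "a \<le> b"
  shows "greedy_potential k a \<le> greedy_potential k b"
proof -
  consider "b \<le> k" | "a \<le> k" "b > k" | "a > k" using assms by linarith
  then show ?thesis
  proof cases
    case 1
    then show ?thesis using assms by (simp add: greedy_potential_def)
  next
    case 2
    then have "0 \<le> k * ln (b / k)" using assms by simp
    then show ?thesis using 2 by (simp add: greedy_potential_def)
  next
    case 3
    then show ?thesis using assms by (simp add: greedy_potential_def divide_right_mono)
  qed
qed

lemma one_minus_inverse_le_ln: "1 - 1 / x \<le> ln x" if "x > 0" for x :: real
  using ln_le_minus_one[of "1 / x"] that by (simp add: ln_div)

text \<open>A choice that dominates at least one new vertex and at least a \<open>1/k\<close>
  fraction of the \<open>a\<close> undominated ones is paid for by the potential: on the linear
  branch directly, on the logarithmic one because \<open>ln (a / b)\<close> \<ge>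
  \<open>1 - b / a\<close> \<ge> \<open>1 / k\<close>.\<close>

lemma greedy_potential_step:
  assumes "k > 0" "b \<le> a - 1" "k * b \<le> k * a - a"
  shows "1 + greedy_potential k b \<le> greedy_potential k a"
proof -
  consider "a \<le> k" | "a > k" "b \<le> k" | "b > k" using assms by linarith
  then show ?thesis
  proof cases
    case 1
    then show ?thesis using assms by (simp add: greedy_potential_def)
  next
    case 2
    then have "1 - k / a \<le> ln (a / k)"
      using one_minus_inverse_le_ln[of "a / k"] assms by simp
    then have "k * (1 - k / a) \<le> k * ln (a / k)"
      using assms by (intro mult_left_mono) auto
    \<comment> \<open>After multiplication by \<open>a\<close> this is the sum of
      \<open>a + k * b\<close> \<le> \<open>k * a\<close> and \<open>(a - k) * b\<close> \<le>
      \<open>(a - k) * k\<close>.\<close>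
    moreover have "1 + b \<le> k + k * (1 - k / a)"
    proof -
      have "(a - k) * b \<le> (a - k) * k"
        using 2 by (intro mult_left_mono) auto
      moreover have "a * (k + k * (1 - k / a)) = 2 * (a * k) - k * k"
        using assms 2 by (simp add: field_simps)
      ultimately have "a * (1 + b) \<le> a * (k + k * (1 - k / a))"
        using assms(3) by (simp add: algebra_simps)
      then show ?thesis using 2 assms by simp
    qed
    ultimately show ?thesis using 2 by (simp add: greedy_potential_def)
  next
    case 3
    then have pos: "a > 0" "b > 0" "a > k" using assms by auto
    then have "1 - b / a \<le> ln (a / b)"
      using one_minus_inverse_le_ln[of "a / b"] by simp
    then have "k * (1 - b / a) \<le> k * ln (a / b)"
      using assms by (intro mult_left_mono) auto
    moreover have "1 \<le> k * (1 - b / a)"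
      using pos assms by (simp add: field_simps)
    moreover have "ln (a / b) = ln (a / k) - ln (b / k)"
      using pos assms by (simp add: ln_div)
    ultimately show ?thesis
      using 3 pos by (simp add: greedy_potential_def algebra_simps)
  qed
qed

text \<open>
  The invariant of the sweep with threshold \<open>d\<close> when the vertices below \<open>v\<close> have been treated:
  \<open>D\<close> is the set of greedy choices and \<open>S\<close> the set to be returned.
\<close>

definition greedy_inv ::
  "nat pair_pre_digraph \<Rightarrow> nat \<Rightarrow> nat \<Rightarrow> nat \<Rightarrow> nat set \<Rightarrow> nat set \<Rightarrow> bool" where
  "greedy_inv G k d v D S \<longleftrightarrow>
     D \<subseteq> S \<and> S \<subseteq> pverts G \<and> card S \<le> 2 * card D \<and>
     (\<forall>u\<in>S. \<exists>w\<in>S. (u, w) \<in> parcs G) \<and>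
     card D + greedy_potential k (card (pverts G - \<Union> (closed_nbhd G ` D)))
       \<le> greedy_potential k (card (pverts G)) \<and>
     (\<forall>u\<in>pverts G. card (closed_nbhd G u - \<Union> (closed_nbhd G ` D)) \<le> d \<and>
       (u < v \<longrightarrow> card (closed_nbhd G u - \<Union> (closed_nbhd G ` D)) < d))"

section \<open>Closed neighbourhoods, domination and degree\<close>

lemma (in pair_graph) closed_nbhd_subset: "v \<in> pverts G \<Longrightarrow> closed_nbhd G v \<subseteq> pverts G"
  using wellformed by (fastforce simp: closed_nbhd_def)

lemma (in pair_graph) finite_closed_nbhd: "finite (closed_nbhd G v)"
proof -
  have "{w. (v, w) \<in> parcs G} \<subseteq> pverts G"
    using wellformed by fastforce
  then show ?thesis
    unfolding closed_nbhd_def using finite_verts by (simp add: finite_subset)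
qed

lemma (in pair_graph) dominating_set_iff:
  "dominating_set G D \<longleftrightarrow> D \<subseteq> pverts G \<and> pverts G \<subseteq> \<Union> (closed_nbhd G ` D)"
  unfolding dominating_set_def closed_nbhd_def by auto

lemma (in pair_graph) card_closed_nbhd_le_max_degree:
  assumes "v \<in> pverts G"
  shows "card (closed_nbhd G v) \<le> max_degree G + 1"
proof -
  have "{w. (v, w) \<in> parcs G} = snd ` out_arcs G v"
    by (auto simp: out_arcs_def image_iff)
  then have "card {w. (v, w) \<in> parcs G} \<le> out_degree G v"
    unfolding out_degree_def using finite_arcs by (simp add: card_image_le out_arcs_def)
  also have "\<dots> \<le> max_degree G"
    unfolding max_degree_def using assms finite_verts by (intro Max_ge) auto
  finally show ?thesis
    unfolding closed_nbhd_def by (intro card_insert_le_m1) auto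
qed

text \<open>Union bound over \<open>A\<close>. Applied to the undominated vertices it bounds the
  threshold from below; applied to all vertices it relates their number to the maximum
  degree.\<close>

lemma (in pair_graph) card_le_of_closed_nbhds:
  assumes "dominating_set G A" "U \<subseteq> pverts G"
    and "\<And>v. v \<in> pverts G \<Longrightarrow> card (closed_nbhd G v \<inter> U) \<le> d"
  shows "card U \<le> card A * d"
proof -
  have A: "A \<subseteq> pverts G" "finite A"
    using assms(1) finite_verts by (auto simp: dominating_set_iff finite_subset)
  have "U = (\<Union>v\<in>A. closed_nbhd G v \<inter> U)"
    using assms(1,2) by (auto simp: dominating_set_iff)
  then have "card U \<le> (\<Sum>v\<in>A. card (closed_nbhd G v \<inter> U))"
    using card_UN_le[OF A(2), of "\<lambda>v. closed_nbhd G v \<inter> U"] by simp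
  also have "\<dots> \<le> card A * d"
    using sum_bounded_above[of A "\<lambda>v. card (closed_nbhd G v \<inter> U)" d] assms(3) A(1) by auto
  finally show ?thesis .
qed

section \<open>Preservation of the sweep invariant\<close>

lemma greedy_inv_init:
  assumes "pair_graph G"
  shows "greedy_inv G k (card (pverts G)) 0 {} {}"
proof -
  interpret pair_graph G by fact
  show ?thesis
    using closed_nbhd_subset finite_verts by (auto simp: greedy_inv_def card_mono)
qed

lemma greedy_inv_skip:
  assumes "greedy_inv G k d v D S" "card (closed_nbhd G v - \<Union> (closed_nbhd G ` D)) < d"
  shows "greedy_inv G k d (Suc v) D S"
  using assms by (auto simp: greedy_inv_def less_Suc_eq)

text \<open>After a full sweep the strict bound holds for every vertex, and \<open>< Suc d\<close>
  means \<le> \<open>d\<close>. At position 0 the strict clause is vacuous again.\<close>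

lemma greedy_inv_next_threshold:
  assumes "greedy_inv G k (Suc d) n D S" "pverts G = {0..<n}"
  shows "greedy_inv G k d 0 D S"
  using assms by (auto simp: greedy_inv_def less_Suc_eq_le)

text \<open>No closed neighbourhood has more than \<open>d\<close> undominated vertices, so a vertex
  with at least \<open>d\<close> of them is a greedy choice. Adding \<open>x\<close> at once makes
  \<open>v\<close> and \<open>x\<close> partners of each other and costs at most two elements of
  \<open>S\<close> per element of \<open>D\<close>; domination is counted through \<open>D\<close>
  alone.\<close>

lemma greedy_inv_choose:
  assumes "pair_graph G"
    and inv: "greedy_inv G k d v D S" and A: "dominating_set G A" "k = card A" "k > 0"
    and v: "v \<in> pverts G" "(v, x) \<in> parcs G" "d > 0"
    and large: "d \<le> card (closed_nbhd G v - \<Union> (closed_nbhd G ` D))"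
  shows "greedy_inv G k d (Suc v) (insert v D) (insert x (insert v S))"
proof -
  interpret pair_graph G by fact
  define C where "C = \<Union> (closed_nbhd G ` D)"
  define U where "U = pverts G - C"
  have inv':
    "D \<subseteq> S" "S \<subseteq> pverts G" "card S \<le> 2 * card D"
    "\<And>u. u \<in> S \<Longrightarrow> \<exists>w\<in>S. (u, w) \<in> parcs G"
    "card D + greedy_potential k (card U) \<le> greedy_potential k (card (pverts G))"
    "\<And>u. u \<in> pverts G \<Longrightarrow> card (closed_nbhd G u - C) \<le> d"
    "\<And>u. u \<in> pverts G \<Longrightarrow> u < v \<Longrightarrow> card (closed_nbhd G u - C) < d"
    using inv by (auto simp: greedy_inv_def C_def U_def)
  have fin: "finite S" "finite D" "finite U"
    using inv'(1,2) finite_verts by (auto simp: U_def dest: finite_subset)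
  have x: "x \<in> pverts G" "(x, v) \<in> parcs G"
    using v wellformed[of "(v, x)"] arcs_symmetric[of v x] by auto
  have large': "d \<le> card (closed_nbhd G v - C)" using large by (simp add: C_def)
  \<comment> \<open>Makes \<open>card D\<close> grow by exactly one: the closed neighbourhood of a
    vertex of \<open>D\<close> has nothing undominated, while \<open>d > 0\<close>.\<close>
  have "v \<notin> D"
  proof
    assume "v \<in> D"
    then have "closed_nbhd G v - C = {}" by (auto simp: C_def)
    then have "card (closed_nbhd G v - C) = 0" by (simp only: card.empty)
    then show False using large' v(3) by linarith
  qed
  have C': "\<Union> (closed_nbhd G ` insert v D) = C \<union> closed_nbhd G v"
    by (auto simp: C_def)
  have "pverts G - (C \<union> closed_nbhd G v) = U - (closed_nbhd G v - C)"
    by (auto simp: U_def)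
  moreover have sub: "closed_nbhd G v - C \<subseteq> U"
    using closed_nbhd_subset[OF v(1)] by (auto simp: U_def)
  ultimately have cU': "card (pverts G - (C \<union> closed_nbhd G v)) = card U - card (closed_nbhd G v - C)"
    using fin(3) by (simp add: card_Diff_subset finite_subset)
  have le: "card (closed_nbhd G v - C) \<le> card U"
    using sub fin(3) by (simp add: card_mono)
  define b where "b = card (pverts G - (C \<union> closed_nbhd G v))"
  have b: "b + d \<le> card U" using cU' le large' by (simp add: b_def)
  have "card U \<le> card A * d"
  proof (rule card_le_of_closed_nbhds[OF A(1)])
    fix u assume u: "u \<in> pverts G"
    have "closed_nbhd G u \<inter> U = closed_nbhd G u - C"
      using closed_nbhd_subset[OF u] by (auto simp: U_def)
    then show "card (closed_nbhd G u \<inter> U) \<le> d" using inv'(6)[OF u] by simp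
  qed (simp add: U_def)
  \<comment> \<open>As \<open>card U\<close> \<le> \<open>k * d\<close>, the \<open>d\<close> or
    more newly dominated vertices are at least a \<open>1/k\<close> fraction of \<open>U\<close>, as
    \<open>greedy_potential_step\<close> requires.\<close>
  then have "card A * b + card U \<le> card A * (b + d)"
    by (simp add: algebra_simps)
  also have "\<dots> \<le> card A * card U" using b by (rule mult_le_mono2)
  finally have "real (card A * b + card U) \<le> real (card A * card U)"
    by (rule of_nat_mono)
  then have "1 + greedy_potential k b \<le> greedy_potential k (card U)"
    using b A(2,3) v(3) by (intro greedy_potential_step) (auto simp: algebra_simps)
  then have pot: "card (insert v D) + greedy_potential k b \<le> greedy_potential k (card (pverts G))"
    using inv'(5) \<open>v \<notin> D\<close> fin by simp
  have shrink: "card (closed_nbhd G u - (C \<union> closed_nbhd G v)) \<le> card (closed_nbhd G u - C)" for u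
    using finite_closed_nbhd by (intro card_mono) auto
  \<comment> \<open>A chosen vertex has nothing undominated left around it, so the sweep can pass
    on.\<close>
  have "card (closed_nbhd G v - (C \<union> closed_nbhd G v)) = 0"
    by (simp add: Diff_eq_empty_iff[THEN iffD2])
  then have "card (closed_nbhd G u - (C \<union> closed_nbhd G v)) < d"
    if "u \<in> pverts G" "u < Suc v" for u
    using inv'(7)[of u] shrink[of u] that v(3) by (cases "u = v") auto
  moreover have "card (closed_nbhd G u - (C \<union> closed_nbhd G v)) \<le> d" if "u \<in> pverts G" for u
    using inv'(6)[OF that] shrink[of u] by simp
  moreover have "card (insert x (insert v S)) \<le> 2 * card (insert v D)"
    using inv'(3) fin \<open>v \<notin> D\<close> by (simp add: card_insert_if)
  moreover have "\<forall>u\<in>insert x (insert v S). \<exists>w\<in>insert x (insert v S). (u, w) \<in> parcs G"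
    using inv'(4) v(2) x(2) by blast
  ultimately show ?thesis
    unfolding greedy_inv_def C' b_def[symmetric] using pot inv'(1,2) v(1) x(1) by auto
qed

text \<open>Threshold 0 leaves no undominated vertex, so \<open>D\<close> and hence \<open>S\<close>
  dominates. A neighbour inside \<open>S\<close> gives the distance condition, even with distance at
  most 1.\<close>

lemma greedy_inv_final:
  assumes "pair_graph G" and inv: "greedy_inv G k 0 0 D S" and k: "k > 0"
    and n: "card (pverts G) \<le> k * (max_degree (with_proj G) + 1)"
  shows "semitotal_dominating_set (with_proj G) S"
    and "real (card S) \<le> 2 * (k + k * ln (real (max_degree (with_proj G)) + 1))"
proof -
  interpret pair_graph G by fact
  have S: "D \<subseteq> S" "S \<subseteq> pverts G" "\<And>u. u \<in> S \<Longrightarrow> \<exists>w\<in>S. (u, w) \<in> parcs G"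
    using inv by (auto simp: greedy_inv_def)
  have cov: "closed_nbhd G u \<subseteq> \<Union> (closed_nbhd G ` D)" if "u \<in> pverts G" for u
    using inv that finite_closed_nbhd by (auto simp: greedy_inv_def)
  have "pverts G \<subseteq> \<Union> (closed_nbhd G ` D)"
    using cov by (force simp: closed_nbhd_def)
  then have "dominating_set G S"
    using S(1,2) by (fastforce simp: dominating_set_iff)
  moreover have "\<exists>v\<in>S. v \<noteq> u \<and> distance G u v \<le> 2" if u: "u \<in> S" for u
  proof -
    obtain v where v: "v \<in> S" "(u, v) \<in> parcs G" using S(3) u by blast
    have "awalk u [(u, v)] v"
      using v u S(2) by (auto simp: awalk_def)
    from min_cost_le_walk_cost[OF this, of "\<lambda>_. 1"]
    have "distance G u v \<le> 1"
      by (simp add: distance_def one_ereal_def)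
    then have "distance G u v \<le> 2"
      by (rule order_trans) simp
    moreover have "v \<noteq> u" using v no_loops by fastforce
    ultimately show ?thesis using v by blast
  qed
  ultimately show "semitotal_dominating_set G S"
    by (simp add: semitotal_dominating_set_def)
  let ?m = "real (max_degree G) + 1"
  have "0 \<le> greedy_potential k (card (pverts G - \<Union> (closed_nbhd G ` D)))"
    using k greedy_potential_mono[of k 0] by (simp add: greedy_potential_def)
  then have "card D \<le> greedy_potential k (card (pverts G))"
    using inv by (simp add: greedy_inv_def)
  also have "\<dots> \<le> greedy_potential k (k * ?m)"
    using n k of_nat_mono[OF n, where ?'a = real] by (intro greedy_potential_mono) (auto simp: algebra_simps)
  \<comment> \<open>\<open>?m\<close> is at least 1; if it is 1, the linear branch gives
    \<open>k\<close> and the logarithm vanishes.\<close>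
  also have "\<dots> = k + k * ln ?m"
    using k by (auto simp: greedy_potential_def)
  finally show "real (card S) \<le> 2 * (k + k * ln ?m)"
    using inv by (simp add: greedy_inv_def)
qed

section \<open>The program\<close>

abbreviation row_entry :: aexp where
  "row_entry \<equiv> Cell ''adj'' (Plus (var ''r'') (var ''w''))"

text \<open>
  The matrix entries and the entries of \<open>''cov''\<close> are 0 or 1, so truncated subtraction tells
  whether the vertex \<open>''w''\<close> is an undominated neighbour of \<open>''v''\<close>.
\<close>

definition count_prog :: com where
  "count_prog = Seq (set_var ''c'' (Minus (Const 1) (Cell ''cov'' (var ''v''))))
     (For ''w'' (var ''n'')
       (set_var ''c'' (Plus (var ''c'') (Minus row_entry (Cell ''cov'' (var ''w''))))))"

definition choose_prog :: com where
  "choose_prog = Seq (Assign ''out'' (var ''v'') (Const 1))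
     (Seq (Assign ''cov'' (var ''v'') (Const 1))
     (Seq (For ''w'' (var ''n'')
            (Cond (Less (Const 0) row_entry)
              (Seq (Assign ''cov'' (var ''w'') (Const 1)) (set_var ''x'' (var ''w'')))
              Skip))
       (Assign ''out'' (var ''x'') (Const 1))))"

text \<open>\<open>r\<close> holds the row offset \<open>v * n\<close>, built by repeated addition
  since the machine cannot multiply.\<close>

definition sweep_prog :: com where
  "sweep_prog = Seq (set_var ''r'' (Const 0))
     (For ''v'' (var ''n'')
       (Seq count_prog
       (Seq (Cond (Less (var ''c'') (Minus (var ''n'') (var ''j''))) Skip choose_prog)
         (set_var ''r'' (Plus (var ''r'') (var ''n''))))))"

text \<open>Round \<open>j\<close> has threshold \<open>n - j\<close>, so the thresholds run from
  \<open>n\<close> down to 1.\<close>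

definition greedy_prog :: com where
  "greedy_prog = For ''j'' (var ''n'') sweep_prog"

text \<open>\<open>C\<close> will be the set dominated by the greedy choices, while \<open>S\<close>
  also contains their added neighbours. \<open>cov\<close> must be exactly 0 or 1 because it is
  subtracted; \<open>out\<close> is only tested for being nonzero.\<close>

definition mem ::
  "nat pair_pre_digraph \<Rightarrow> nat \<Rightarrow> nat set \<Rightarrow> nat set \<Rightarrow> state \<Rightarrow> bool" where
  "mem G n C S s \<longleftrightarrow> s ''n'' 0 = n \<and>
     (\<forall>v<n. \<forall>w<n. s ''adj'' (v * n + w) = of_bool ((v, w) \<in> parcs G)) \<and>
     (\<forall>w<n. s ''cov'' w = of_bool (w \<in> C)) \<and>
     (\<forall>w<n. s ''out'' w \<noteq> 0 \<longleftrightarrow> w \<in> S)"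

section \<open>Correctness and running time of the program\<close>

lemma wp_count_prog:
  assumes G: "pair_graph G" "pverts G = {0..<n}"
    and s: "mem G n C S s" "s ''j'' 0 = j" "s ''v'' 0 = v" "s ''r'' 0 = v * n" "v < n"
  shows "wp count_prog (3 + n * 3)
    (\<lambda>s. mem G n C S s \<and> s ''j'' 0 = j \<and> s ''v'' 0 = v \<and> s ''r'' 0 = v * n \<and>
      s ''c'' 0 = card (closed_nbhd G v - C)) s"
proof -
  interpret pair_graph G by fact
  let ?M = "\<lambda>k. insert v {w. w < k \<and> (v, w) \<in> parcs G} - C"
  let ?I = "\<lambda>k s. mem G n C S s \<and> s ''j'' 0 = j \<and> s ''v'' 0 = v \<and> s ''r'' 0 = v * n \<and>
    s ''c'' 0 = card (?M k)"
  \<comment> \<open>The truncated difference is 1 exactly for a neighbour outside \<open>C\<close>.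
    Since the graph is loop-free, \<open>v\<close>, counted before the iteration, is not counted
    again.\<close>
  have Suc_M: "card (?M (Suc k)) = card (?M k) + (of_bool ((v, k) \<in> parcs G) - of_bool (k \<in> C))" for k
  proof (cases "(v, k) \<in> parcs G \<and> k \<notin> C")
    case True
    then have "?M (Suc k) = insert k (?M k)" "k \<noteq> v"
      using no_loops by (fastforce simp: less_Suc_eq)+
    then show ?thesis using True by (simp add: card_insert_if)
  next
    case False
    then have "?M (Suc k) = ?M k" by (auto simp: less_Suc_eq)
    then show ?thesis using False by auto
  qed
  have M: "?M n = closed_nbhd G v - C"
    using wellformed G(2) by (fastforce simp: closed_nbhd_def)
  have M0: "card (?M 0) = 1 - of_bool (v \<in> C)" by (simp add: insert_Diff_if)
  have "wp count_prog (Suc (2 + n * (1 + 2))) (?I n) s"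
    unfolding count_prog_def
  proof (rule wp_Assign_Seq, rule wp_For[where I = ?I and N = n], goal_cases)
    case 1
    then show ?case using s M0 by (simp add: mem_def)
  next
    case (2 k s)
    then show ?case by (simp add: mem_def)
  next
    case (3 k s)
    then show ?case
      using s(5) Suc_M[of k] unfolding One_nat_def by (intro wp_Assign) (simp add: mem_def)
  qed
  then show ?thesis unfolding M by (simp add: numeral_3_eq_3)
qed

lemma wp_choose_prog:
  assumes G: "pair_graph G" "pverts G = {0..<n}" "\<exists>w. (v, w) \<in> parcs G"
    and s: "mem G n C S s" "s ''j'' 0 = j" "s ''v'' 0 = v" "s ''r'' 0 = v * n" "v < n"
  shows "wp choose_prog (5 + n * 5)
    (\<lambda>s. \<exists>x. (v, x) \<in> parcs G \<and> mem G n (C \<union> closed_nbhd G v) (insert x (insert v S)) s \<and>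
      s ''j'' 0 = j \<and> s ''v'' 0 = v \<and> s ''r'' 0 = v * n) s"
    (is "wp _ _ ?Q _")
proof -
  interpret pair_graph G by fact
  let ?C = "\<lambda>k. C \<union> insert v {w. w < k \<and> (v, w) \<in> parcs G}"
  \<comment> \<open>The claim on \<open>x\<close> is conditional because \<open>x\<close> may hold
    an old value until a neighbour of \<open>v\<close> is met.\<close>
  let ?I = "\<lambda>k s. mem G n (?C k) (insert v S) s \<and> s ''j'' 0 = j \<and> s ''v'' 0 = v \<and>
    s ''r'' 0 = v * n \<and> ((\<exists>w<k. (v, w) \<in> parcs G) \<longrightarrow> (v, s ''x'' 0) \<in> parcs G)"
  have C: "?C n = C \<union> closed_nbhd G v"
    using wellformed G(2) by (fastforce simp: closed_nbhd_def)
  have ex: "\<exists>w<n. (v, w) \<in> parcs G"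
    using wellformed G(2,3) by fastforce
  have "wp choose_prog (Suc (Suc ((2 + n * (3 + 2)) + Suc 0))) ?Q s"
    unfolding choose_prog_def
  proof (rule wp_Assign_Seq, rule wp_Assign_Seq, rule wp_Seq, rule wp_For[where I = ?I and N = n],
      goal_cases)
    case 1
    then show ?case using s by (simp add: mem_def)
  next
    case (2 k s)
    then show ?case by (simp add: mem_def)
  next
    case (3 k s)
    then have entry: "aval row_entry s = of_bool ((v, k) \<in> parcs G)"
      using s(5) by (simp add: mem_def)
    show ?case
      unfolding numeral_3_eq_3
    proof (rule wp_Cond, goal_cases)
      case 1
      then have "(v, k) \<in> parcs G" using entry by simp
      then show ?case
        using 3 by (intro wp_Assign_Seq wp_Assign) (simp add: mem_def less_Suc_eq)
    next
      case 2
      then have "(v, k) \<notin> parcs G" using entry by simp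
      then have "{w. w < Suc k \<and> (v, w) \<in> parcs G} = {w. w < k \<and> (v, w) \<in> parcs G}"
        "(\<exists>w<Suc k. (v, w) \<in> parcs G) \<longleftrightarrow> (\<exists>w<k. (v, w) \<in> parcs G)"
        by (auto simp: less_Suc_eq)
      then show ?case
        using 3 by (intro wp_Skip) (simp add: mem_def)
    qed
  next
    case (4 s)
    then have "(v, s ''x'' 0) \<in> parcs G" using ex by blast
    with 4 show ?case
      unfolding C by (intro wp_Assign exI[of _ "s ''x'' 0"]) (auto simp: mem_def)
  qed
  then show ?thesis by (rule wp_mono) auto
qed

lemma wp_sweep_prog:
  assumes G: "pair_graph G" "pverts G = {0..<n}" "\<And>v. v < n \<Longrightarrow> \<exists>w. (v, w) \<in> parcs G"
    and A: "dominating_set G A" "k = card A" "k > 0" and "j < n"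
    and s: "mem G n (\<Union> (closed_nbhd G ` D)) S s" "s ''j'' 0 = j" "greedy_inv G k (n - j) 0 D S"
  shows "wp sweep_prog (3 + n * (12 + n * 8))
    (\<lambda>s. s ''j'' 0 = j \<and> (\<exists>D S. mem G n (\<Union> (closed_nbhd G ` D)) S s \<and>
       greedy_inv G k (n - Suc j) 0 D S)) s"
    (is "wp _ _ ?Q _")
proof -
  let ?I = "\<lambda>v s. s ''j'' 0 = j \<and> s ''r'' 0 = v * n \<and>
    (\<exists>D S. mem G n (\<Union> (closed_nbhd G ` D)) S s \<and> greedy_inv G k (n - j) v D S)"
  \<comment> \<open>Per vertex: \<open>3 + n * 3\<close> for counting, \<open>6 + n * 5\<close> for
    the conditional, 1 for the row offset, 2 for the loop.\<close>
  have "wp sweep_prog (Suc (2 + n * (10 + n * 8 + 2))) ?Q s"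
    unfolding sweep_prog_def
  proof (rule wp_Assign_Seq, rule wp_For[where I = ?I and N = n], goal_cases)
    case 1
    then show ?case using s by (auto simp: mem_def)
  next
    case (2 v s)
    then show ?case by (auto simp: mem_def)
  next
    case (3 v s)
    let ?R = "\<lambda>s. s ''v'' 0 = v \<and> ?I (Suc v) (s(''v'' := (s ''v'')(0 := Suc v)))"
    let ?J = "\<lambda>s. s ''j'' 0 = j \<and> s ''v'' 0 = v \<and> s ''r'' 0 = v * n \<and>
      (\<exists>D S. mem G n (\<Union> (closed_nbhd G ` D)) S s \<and> greedy_inv G k (n - j) (Suc v) D S)"
    from 3 obtain D S where DS: "mem G n (\<Union> (closed_nbhd G ` D)) S s"
      "greedy_inv G k (n - j) v D S" by blast
    have J: "wp (set_var ''r'' (Plus (var ''r'') (var ''n''))) (Suc 0) ?R s" if "?J s" for s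
      using that by (intro wp_Assign) (auto simp: mem_def)
    have "wp (Cond (Less (var ''c'') (Minus (var ''n'') (var ''j''))) Skip choose_prog)
        (Suc (5 + n * 5)) ?J s"
      if s: "mem G n (\<Union> (closed_nbhd G ` D)) S s" "s ''j'' 0 = j" "s ''v'' 0 = v"
        "s ''r'' 0 = v * n" "s ''c'' 0 = card (closed_nbhd G v - \<Union> (closed_nbhd G ` D))" for s
    proof (rule wp_Cond)
      assume b: "bval (Less (var ''c'') (Minus (var ''n'') (var ''j''))) s"
      have "?J s"
        using s b greedy_inv_skip[OF DS(2)] by (auto simp: mem_def)
      then have "wp Skip (Suc (4 + n * 5)) ?J s" by (rule wp_Skip[where Q = ?J])
      then show "wp Skip (5 + n * 5) ?J s" by simp
    next
      assume "\<not> bval (Less (var ''c'') (Minus (var ''n'') (var ''j''))) s"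
      then have large: "n - j \<le> card (closed_nbhd G v - \<Union> (closed_nbhd G ` D))"
        using s by (auto simp: mem_def)
      have inv: "greedy_inv G k (n - j) (Suc v) (insert v D) (insert x (insert v S))"
        if "(v, x) \<in> parcs G" for x
        using 3(1) G(2) \<open>j < n\<close> large that
        by (intro greedy_inv_choose[OF G(1) DS(2) A]) auto
      have C: "\<Union> (closed_nbhd G ` insert v D) = \<Union> (closed_nbhd G ` D) \<union> closed_nbhd G v"
        by auto
      show "wp choose_prog (5 + n * 5) ?J s"
        using wp_choose_prog[OF G(1,2) G(3)[OF 3(1)] s(1-4) 3(1)]
      proof (rule wp_mono)
        fix s' assume "\<exists>x. (v, x) \<in> parcs G \<and>
          mem G n (\<Union> (closed_nbhd G ` D) \<union> closed_nbhd G v) (insert x (insert v S)) s' \<and>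
          s' ''j'' 0 = j \<and> s' ''v'' 0 = v \<and> s' ''r'' 0 = v * n"
        then show "?J s'" using inv unfolding C[symmetric] by blast
      qed simp
    qed
    then have "wp (Seq (Cond (Less (var ''c'') (Minus (var ''n'') (var ''j''))) Skip choose_prog)
          (set_var ''r'' (Plus (var ''r'') (var ''n'')))) (Suc (5 + n * 5) + Suc 0) ?R s"
      if "mem G n (\<Union> (closed_nbhd G ` D)) S s \<and> s ''j'' 0 = j \<and> s ''v'' 0 = v \<and>
        s ''r'' 0 = v * n \<and> s ''c'' 0 = card (closed_nbhd G v - \<Union> (closed_nbhd G ` D))" for s
      using that by (intro wp_Seq wp_mono[OF _ order_refl J, of _ _ ?J]) auto
    from wp_mono[OF wp_count_prog[OF G(1,2) DS(1)] order_refl this]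
    have "wp count_prog (3 + n * 3)
        (wp (Seq (Cond (Less (var ''c'') (Minus (var ''n'') (var ''j''))) Skip choose_prog)
          (set_var ''r'' (Plus (var ''r'') (var ''n'')))) (Suc (5 + n * 5) + Suc 0) ?R) s"
      using 3 by auto
    from wp_Seq[OF this] show ?case by (rule wp_mono) auto
  next
    case (4 s)
    have "n - j = Suc (n - Suc j)" using \<open>j < n\<close> by simp
    with 4 show ?case using greedy_inv_next_threshold[OF _ G(2)] by metis
  qed
  then show ?thesis by (rule wp_mono) auto
qed

lemma mem_input_state:
  assumes "pverts G = {0..<n}"
  shows "mem G n {} {} (input_state G)"
proof -
  \<comment> \<open>Every pair of vertices addresses a cell inside the matrix region of the
    input.\<close>
  have "v * n + w < n * n" if "v < n" "w < n" for v w
  proof -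
    have "v * n + w < Suc v * n" using that by simp
    also have "\<dots> \<le> n * n" using that by (intro mult_le_mono1) simp
    finally show ?thesis .
  qed
  then show ?thesis using assms by (auto simp: mem_def input_state_def Let_def)
qed

lemma wp_greedy_prog:
  assumes G: "pair_graph G" "pverts G = {0..<n}" "\<And>v. v < n \<Longrightarrow> \<exists>w. (v, w) \<in> parcs G"
    and A: "dominating_set G A" "k = card A" "k > 0"
  shows "wp greedy_prog (2 + n * (5 + n * (12 + n * 8)))
    (\<lambda>s. \<exists>D. greedy_inv G k 0 0 D (output_set G s)) (input_state G)"
proof -
  let ?I = "\<lambda>j s. \<exists>D S. mem G n (\<Union> (closed_nbhd G ` D)) S s \<and> greedy_inv G k (n - j) 0 D S"
  have "wp greedy_prog (2 + n * ((3 + n * (12 + n * 8)) + 2))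
    (\<lambda>s. \<exists>D. greedy_inv G k 0 0 D (output_set G s)) (input_state G)"
    unfolding greedy_prog_def
  proof (rule wp_For[where I = ?I and N = n], goal_cases)
    case 1
    have "greedy_inv G k n 0 {} {}" using greedy_inv_init[OF G(1), of k] G(2) by simp
    then show ?case
      using mem_input_state[OF G(2)]
      by (intro exI[of _ "{}"]) (auto simp: mem_def)
  next
    case (2 j s)
    then show ?case by (auto simp: mem_def)
  next
    case (3 j s)
    then obtain D S where "mem G n (\<Union> (closed_nbhd G ` D)) S s" "greedy_inv G k (n - j) 0 D S"
      by blast
    from wp_sweep_prog[OF G A 3(1) this(1) 3(3) this(2)] show ?case
      by (rule wp_mono) (auto simp: mem_def)
  next
    case (4 s)
    then obtain D S where DS: "mem G n (\<Union> (closed_nbhd G ` D)) S s" "greedy_inv G k 0 0 D S"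
      by auto
    then have "output_set G s = S"
      using G(2) by (auto simp: output_set_def mem_def greedy_inv_def)
    then show ?case using DS by auto
  qed
  then show ?thesis by (simp add: add.commute)
qed

text \<open>A walk to a second vertex has a first arc. This guarantees that every greedy choice
  finds a partner.\<close>

lemma (in pair_graph) exists_neighbour:
  assumes "Digraph_Component.connected G" "card (pverts G) \<ge> 2" "v \<in> pverts G"
  shows "\<exists>w. (v, w) \<in> parcs G"
proof -
  have sc: "strongly_connected G"
    using pair_sym_arcs assms(1) by (rule symmetric_connected_imp_strongly_connected)
  obtain u where u: "u \<in> pverts G" "u \<noteq> v"
    using assms(2,3) by (metis card_le_Suc0_iff_eq finite_verts not_less_eq_eq numeral_2_eq_2)
  have "v \<rightarrow>\<^sup>*\<^bsub>with_proj G\<^esub> u"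
    using sc u assms(3) by (auto simp: strongly_connected_def)
  then show ?thesis
    using u(2) by (metis converse_reachable_cases)
qed

section \<open>Polynomial running time and the approximation ratio\<close>

theorem theorem10:
  shows "\<exists>(c :: com) (p :: nat poly). \<forall>G :: nat pair_pre_digraph.
    pair_graph G \<longrightarrow> Digraph_Component.connected (with_proj G) \<longrightarrow> card (pverts G) \<ge> 2 \<longrightarrow>
    pverts G = {0..<card (pverts G)} \<longrightarrow>
    (\<exists>t s. runs c (input_state G) t s
         \<and> t \<le> poly p (card (pverts G))
         \<and> semitotal_dominating_set (with_proj G) (output_set G s)
         \<and> real (card (output_set G s))
             \<le> (2 + 3 * ln (real (max_degree (with_proj G)) + 1))
                 * real (semitotal_domination_number (with_proj G)))"
\<comment> \<open>The coefficients are those of the time bound of \<open>wp_greedy_prog\<close> in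
  Horner form.\<close>
proof (intro exI[of _ greedy_prog] exI[of _ "[:2, 5, 12, 8:]"] allI impI)
  fix G :: "nat pair_pre_digraph"
  assume G: "pair_graph G" "Digraph_Component.connected (with_proj G)" "card (pverts G) \<ge> 2"
    "pverts G = {0..<card (pverts G)}"
  interpret pair_graph G by fact
  define n where "n = card (pverts G)"
  define k where "k = semitotal_domination_number G"
  let ?ln = "ln (real (max_degree G) + 1)"
  have "k \<in> card ` {D. semitotal_dominating_set G D}"
    unfolding k_def semitotal_domination_number_def
    using finite_semitotal_dominating_sets[of G] semitotal_dominating_set_verts[OF G(1-3)] finite_verts
    by (intro Min_in) auto
  then obtain A where A: "dominating_set G A" "k = card A"
    by (auto simp: semitotal_dominating_set_def)
  \<comment> \<open>A minimum semitotal dominating set dominates, so \<open>k\<close> closed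
    neighbourhoods of size at most \<Delta> + 1 cover the graph.\<close>
  have le: "card (pverts G) \<le> card A * (max_degree G + 1)"
  proof (rule card_le_of_closed_nbhds[OF A(1) order_refl])
    fix v assume "v \<in> pverts G"
    then show "card (closed_nbhd G v \<inter> pverts G) \<le> max_degree G + 1"
      using card_closed_nbhd_le_max_degree[of v] closed_nbhd_subset[of v]
      by (simp add: Int_absorb2)
  qed
  have k: "k > 0"
    using le G(3) A(2) by (cases k) auto
  have n: "pverts G = {0..<n}" "\<And>v. v < n \<Longrightarrow> \<exists>w. (v, w) \<in> parcs G"
    using G(4) exists_neighbour[OF G(2,3)] unfolding n_def by (metis, metis atLeastLessThan_iff le0)
  obtain t s D where run: "runs greedy_prog (input_state G) t s"
      "t \<le> 2 + n * (5 + n * (12 + n * 8))" and inv: "greedy_inv G k 0 0 D (output_set G s)"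
    using wp_greedy_prog[OF G(1) n A k] unfolding wp_def by blast
  have "real (card (output_set G s)) \<le> 2 * (k + k * ?ln)"
    using greedy_inv_final(2)[OF G(1) inv] k le A(2) by simp
  \<comment> \<open>The left side is \<open>(2 + 2 * ?ln) * k\<close>; the slack is
    \<open>?ln * k\<close> \<ge> 0.\<close>
  also have "\<dots> \<le> (2 + 3 * ?ln) * k"
    by (simp add: algebra_simps)
  finally show "\<exists>t s. runs greedy_prog (input_state G) t s
         \<and> t \<le> poly [:2, 5, 12, 8:] (card (pverts G))
         \<and> semitotal_dominating_set (with_proj G) (output_set G s)
         \<and> real (card (output_set G s))
             \<le> (2 + 3 * ln (real (max_degree (with_proj G)) + 1))
                 * real (semitotal_domination_number (with_proj G))"
    using run greedy_inv_final(1)[OF G(1) inv] k le A(2)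
    by (intro exI[of _ t] exI[of _ s]) (simp add: n_def k_def)
qed

end
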